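(* Let $Y=(Y,\succcurlyeq_Y)$ be a Hilbert poset. Then there exists an order-preserving geodesic ray $\sigma:[0,\infty)\to Y$ whose Busemann function is $\succcurlyeq_Y$-decreasing.
   Context: All linear spaces are real. A partial order is a reflexive, transitive, antisymmetric binary relation. A vector order on a linear space $Y$ is a partial order $\succcurlyeq$ on $Y$ such that $x\succcurlyeq y$ implies $\lambda x\succcurlyeq\lambda y$ for all real $\lambda\geq 0$ and $x+z\succcurlyeq y+z$ for all $z\in Y$. A Hilbert poset is a Hilbert space $Y$ together with a vector order $\succcurlyeq$ that is a closed subset of $Y\times Y$; it is viewed as a metric space via its norm, with metric $d_Y$. A geodesic ray in $Y$ is a map $\sigma:[0,\infty)\to Y$ with $d_Y(\sigma(s),\sigma(t))=|s-t|$ for all $s,t\geq 0$; it is order-preserving if $\sigma(s)\succcurlyeq_Y\sigma(t)$ whenever $s\geq t\geq 0$. Its Busemann function is $B_\sigma:Y\to\mathbb{R}$, $B_\sigma(a):=\lim_{t\to\infty}(d_Y(a,\sigma(t))-t)$ (the limit always exists). $B_\sigma$ is $\succcurlyeq_Y$-decreasing if $a\succcurlyeq_Y b$ implies $B_\sigma(a)\leq B_\sigma(b)$.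
   Formalization: The order is additionally assumed not to be mere equality (some two distinct points are comparable); equality is a closed vector order on any Hilbert space but admits no order-preserving geodesic ray, so the claim fails exactly in that case. *)

theory Defs
  imports "HOL-Analysis.Analysis"
begin

text \<open>Relations are written \<open>ge x y\<close> for \<open>x \<succcurlyeq> y\<close>.\<close>

definition vector_order :: "('a::real_vector \<Rightarrow> 'a \<Rightarrow> bool) \<Rightarrow> bool" where
  "vector_order ge \<longleftrightarrow>
     reflp ge \<and> transp ge \<and> antisymp ge \<and>
     (\<forall>x y. ge x y \<longrightarrow>
        (\<forall>r::real. r \<ge> 0 \<longrightarrow> ge (r *\<^sub>R x) (r *\<^sub>R y)) \<and>
        (\<forall>z. ge (x + z) (y + z)))"

definition hilbert_poset :: "('a::{real_inner,complete_space} \<Rightarrow> 'a \<Rightarrow> bool) \<Rightarrow> bool" where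
  "hilbert_poset ge \<longleftrightarrow> vector_order ge \<and> closed {(x, y). ge x y}"

text \<open>A ray is a total function on \<open>real\<close> of which only the values on \<open>[0, \<infinity>)\<close> matter.\<close>

definition geodesic_ray :: "(real \<Rightarrow> 'a::metric_space) \<Rightarrow> bool" where
  "geodesic_ray \<sigma> \<longleftrightarrow> (\<forall>s\<ge>0. \<forall>t\<ge>0. dist (\<sigma> s) (\<sigma> t) = \<bar>s - t\<bar>)"

definition order_preserving_ray :: "('a \<Rightarrow> 'a \<Rightarrow> bool) \<Rightarrow> (real \<Rightarrow> 'a) \<Rightarrow> bool" where
  "order_preserving_ray ge \<sigma> \<longleftrightarrow> (\<forall>s t. s \<ge> t \<and> t \<ge> 0 \<longrightarrow> ge (\<sigma> s) (\<sigma> t))"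

definition busemann :: "(real \<Rightarrow> 'a::metric_space) \<Rightarrow> 'a \<Rightarrow> real" where
  "busemann \<sigma> a = Lim at_top (\<lambda>t. dist a (\<sigma> t) - t)"

definition order_decreasing :: "('a \<Rightarrow> 'a \<Rightarrow> bool) \<Rightarrow> ('a \<Rightarrow> real) \<Rightarrow> bool" where
  "order_decreasing ge f \<longleftrightarrow> (\<forall>a b. ge a b \<longrightarrow> f a \<le> f b)"

text \<open>The limit defining the Busemann function of a geodesic ray exists.\<close>

lemma busemann_tendsto:
  assumes "geodesic_ray \<sigma>"
  shows "((\<lambda>t. dist a (\<sigma> t) - t) \<longlongrightarrow> busemann \<sigma> a) at_top"
proof -
  define f where "f t = dist a (\<sigma> t) - t" for t
  have dec: "f t \<le> f s" if "0 \<le> s" "s \<le> t" for s t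
    using assms that dist_triangle[of a "\<sigma> t" "\<sigma> s"]
    by (auto simp: geodesic_ray_def f_def)
  have lower: "- dist a (\<sigma> 0) \<le> f t" if "0 \<le> t" for t
    using assms that dist_triangle[of "\<sigma> 0" "\<sigma> t" a]
    by (auto simp: geodesic_ray_def f_def dist_commute)
  define L where "L = Inf (f ` {0..})"
  have bdd: "bdd_below (f ` {0..})"
    using lower by (auto intro!: bdd_belowI)
  have "(f \<longlongrightarrow> L) at_top"
  proof (rule order_tendstoI)
    fix y assume "y < L"
    moreover have "L \<le> f t" if "0 \<le> t" for t
      unfolding L_def using that bdd by (auto intro!: cInf_lower)
    ultimately show "\<forall>\<^sub>F t in at_top. y < f t"
      by (intro eventually_at_top_linorderI[of 0]) (meson less_le_trans)
  next
    fix y assume "L < y"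
    then obtain s where "0 \<le> s" "f s < y"
      unfolding L_def using cInf_lessD[of "f ` {0..}" y] by auto
    then show "\<forall>\<^sub>F t in at_top. f t < y"
      using dec by (intro eventually_at_top_linorderI[of s]) (meson le_less_trans)
  qed
  then have "(f \<longlongrightarrow> Lim at_top f) at_top"
    using tendsto_Lim[OF trivial_limit_at_top_linorder] by fastforce
  then show ?thesis
    by (simp add: f_def[abs_def] busemann_def)
qed

text \<open>Equality is a closed vector order, but it admits no order-preserving geodesic ray;
  existence of such a ray requires two distinct comparable points.\<close>

lemma hilbert_poset_eq: "hilbert_poset ((=) :: 'a::{real_inner,complete_space} \<Rightarrow> 'a \<Rightarrow> bool)"
proof -
  have "closed {(x, y). (x::'a) = y}"
  proof -
    have "{(x, y). (x::'a) = y} = {z. \<exists>x. z = (x, x)}"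
      by auto
    then show ?thesis
      by (simp only: closed_diagonal)
  qed
  then show ?thesis
    by (auto simp: hilbert_poset_def vector_order_def reflp_def transp_def antisymp_def)
qed

lemma order_preserving_ray_nontrivial:
  assumes "geodesic_ray \<sigma>" "order_preserving_ray ge \<sigma>"
  shows "\<exists>x y. ge x y \<and> x \<noteq> y"
proof -
  have "dist (\<sigma> 1) (\<sigma> 0) = 1" "ge (\<sigma> 1) (\<sigma> 0)"
    using assms by (auto simp: geodesic_ray_def order_preserving_ray_def)
  then show ?thesis
    by (metis dist_self zero_neq_one)
qed

end

theory Submission
  imports Defs "HOL-Real_Asymp.Real_Asymp"
begin

text \<open>Let \<open>C = {c. c \<succcurlyeq> 0}\<close> be the positive cone, which is closed, convex and pointed. Along a line
  \<open>\<sigma> t = t u\<close> in a unit direction \<open>u\<close> the Busemann function is \<open>a \<mapsto> - \<langle>a, u\<rangle>\<close>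
  (\<open>busemann_line\<close>). So \<open>\<sigma>\<close> is order-preserving iff \<open>u \<in> C\<close>, and its Busemann function is
  decreasing iff \<open>u\<close> lies in the dual cone of \<open>C\<close>. It remains to find a nonzero vector in the
  intersection of \<open>C\<close> with its dual cone.

  Take \<open>p \<in> C\<close> with \<open>p \<noteq> 0\<close> and let \<open>u\<close> be the point of least norm in the closed convex set
  \<open>p + C\<close>, which exists by completeness (\<open>least_norm_point_exists\<close>). This set lies in \<open>C\<close>, so
  \<open>u \<in> C\<close>; it is stable under adding elements of \<open>C\<close>, so minimality makes \<open>u\<close> form a nonobtuse
  angle with each of them (\<open>inner_nonneg_if_least_norm_on_ray\<close>); and it omits \<open>0\<close>, since
  \<open>- p \<in> C\<close> would contradict antisymmetry. In the language of Moreau's decomposition, \<open>u\<close> is the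
  projection of \<open>p\<close> to the dual cone.\<close>

text \<open>By the parallelogram identity, points of a convex set whose norms are almost minimal are close
  to each other; hence the parts of the set in balls of radius shrinking to the infimum of the norm
  form a nested sequence of closed sets with diameters tending to zero.\<close>

lemma least_norm_point_exists:
  fixes S :: "'a::{real_inner,complete_space} set"
  assumes "closed S" "convex S" "S \<noteq> {}"
  shows "\<exists>u\<in>S. \<forall>x\<in>S. norm u \<le> norm x"
proof -
  define d where "d = Inf (norm ` S)"
  have bdd: "bdd_below (norm ` S)"
    by (auto intro: bdd_belowI[of _ 0])
  have d_le: "d \<le> norm x" if "x \<in> S" for x
    unfolding d_def using that bdd by (auto intro: cInf_lower)
  have d_nonneg: "0 \<le> d"
    unfolding d_def using assms(3) by (auto intro: cInf_greatest)
  define r where "r n = d + inverse (Suc n)" for n :: nat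
  define T where "T n = S \<inter> cball 0 (r n)" for n
  have r_lim: "r \<longlonglongrightarrow> d"
    unfolding r_def using LIMSEQ_inverse_real_of_nat_add[of d] by simp
  have "\<exists>u. \<Inter> (range T) = {u}"
  proof (rule decreasing_closed_nest_sing)
    show "closed (T n)" for n
      using assms(1) by (auto simp: T_def)
    show "T n \<noteq> {}" for n
    proof -
      have "d < r n" by (simp add: r_def)
      then obtain x where "x \<in> S" "norm x < r n"
        unfolding d_def using cInf_lessD[of "norm ` S" "r n"] assms(3) by auto
      then show ?thesis by (auto simp: T_def intro: less_imp_le)
    qed
    show "T n \<subseteq> T m" if "m \<le> n" for m n
    proof -
      have "r n \<le> r m"
        using that by (simp add: r_def le_imp_inverse_le)
      then show ?thesis by (auto simp: T_def)
    qed
    show "\<exists>n. \<forall>x\<in>T n. \<forall>y\<in>T n. dist x y < e" if "0 < e" for e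
    proof -
      have "(\<lambda>n. 4 * (r n)\<^sup>2 - 4 * d\<^sup>2) \<longlonglongrightarrow> 4 * d\<^sup>2 - 4 * d\<^sup>2"
        by (intro tendsto_intros r_lim)
      then have "\<forall>\<^sub>F n in sequentially. 4 * (r n)\<^sup>2 - 4 * d\<^sup>2 < e\<^sup>2"
        using that by (intro order_tendstoD) auto
      then obtain n where n: "4 * (r n)\<^sup>2 - 4 * d\<^sup>2 < e\<^sup>2"
        by (auto simp: eventually_sequentially)
      have "dist x y < e" if "x \<in> T n" "y \<in> T n" for x y
      proof -
        have "(1/2) *\<^sub>R x + (1/2) *\<^sub>R y \<in> S"
          using that assms(2) by (intro convexD) (auto simp: T_def)
        then have "d \<le> norm ((1/2) *\<^sub>R (x + y))"
          by (intro d_le) (simp add: scaleR_add_right)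
        then have "(2 * d)\<^sup>2 \<le> (norm (x + y))\<^sup>2"
          using d_nonneg by (intro power_mono) auto
        moreover have "(norm x)\<^sup>2 \<le> (r n)\<^sup>2" "(norm y)\<^sup>2 \<le> (r n)\<^sup>2"
          using that by (auto simp: T_def intro: power_mono)
        moreover have "(norm (x - y))\<^sup>2 = 2 * (norm x)\<^sup>2 + 2 * (norm y)\<^sup>2 - (norm (x + y))\<^sup>2"
          by (simp add: power2_norm_eq_inner inner_simps inner_commute)
        ultimately have "(norm (x - y))\<^sup>2 < e\<^sup>2"
          using n by (simp add: power_mult_distrib)
        then show ?thesis
          using \<open>0 < e\<close> by (simp add: dist_norm power2_less_imp_less)
      qed
      then show ?thesis by blast
    qed
  qed
  then obtain u where "u \<in> T n" for n
    by blast
  then have "u \<in> S" "norm u \<le> r n" for n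
    by (auto simp: T_def)
  then have "u \<in> S" "norm u \<le> d"
    using LIMSEQ_le_const[OF r_lim, of "norm u"] by auto
  then show ?thesis
    using d_le order_trans by blast
qed

text \<open>If the inner product were negative, a short step in direction \<open>c\<close> would decrease the norm.\<close>

lemma inner_nonneg_if_least_norm_on_ray:
  fixes u c :: "'a::real_inner"
  assumes least: "\<And>t. 0 < t \<Longrightarrow> norm u \<le> norm (u + t *\<^sub>R c)"
  shows "0 \<le> inner u c"
proof -
  have "0 \<le> 2 * inner u c + t * (norm c)\<^sup>2" if "0 < t" for t
  proof -
    have "(norm u)\<^sup>2 \<le> (norm (u + t *\<^sub>R c))\<^sup>2"
      using least[OF that] by (intro power_mono) auto
    then have "0 \<le> t * (2 * inner u c + t * (norm c)\<^sup>2)"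
      by (simp add: power2_norm_eq_inner inner_simps inner_commute algebra_simps)
    then show ?thesis
      using that by (simp add: zero_le_mult_iff)
  qed
  then have "\<forall>\<^sub>F t in at_right 0. 0 \<le> 2 * inner u c + t * (norm c)\<^sup>2"
    by (intro eventually_at_rightI[of 0 1]) auto
  moreover have "((\<lambda>t. 2 * inner u c + t * (norm c)\<^sup>2) \<longlongrightarrow> 2 * inner u c + 0 * (norm c)\<^sup>2) (at_right 0)"
    by (intro tendsto_intros)
  ultimately have "0 \<le> 2 * inner u c + 0 * (norm c)\<^sup>2"
    by (intro tendsto_lowerbound) auto
  then show ?thesis by simp
qed

lemma geodesic_ray_line:
  fixes u :: "'a::real_inner"
  assumes "norm u = 1"
  shows "geodesic_ray (\<lambda>t. t *\<^sub>R u)"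
  using assms by (simp add: geodesic_ray_def dist_norm flip: scaleR_diff_left)

text \<open>The distance is the hypotenuse of a right triangle whose leg along \<open>u\<close> is \<open>t - \<langle>a, u\<rangle>\<close> and
  whose other leg does not depend on \<open>t\<close>; the latter is negligible in the limit.\<close>

lemma busemann_line:
  fixes u :: "'a::{real_inner,complete_space}"
  assumes "norm u = 1"
  shows "busemann (\<lambda>t. t *\<^sub>R u) a = - inner a u"
proof -
  define m where "m = inner a u"
  define k where "k = (norm (a - m *\<^sub>R u))\<^sup>2"
  have uu: "inner u u = 1"
    using assms by (simp add: norm_eq_1)
  have "dist a (t *\<^sub>R u) = sqrt ((t - m)\<^sup>2 + k)" for t
  proof -
    have "(norm (a - t *\<^sub>R u))\<^sup>2 = (t - m)\<^sup>2 + k"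
      unfolding k_def m_def power2_norm_eq_inner
      by (simp add: inner_simps uu inner_commute[of u a] power2_eq_square algebra_simps)
    then show ?thesis
      by (metis dist_norm norm_ge_zero real_sqrt_unique)
  qed
  moreover have "((\<lambda>t. sqrt ((t - m)\<^sup>2 + k) - t) \<longlongrightarrow> - m) at_top"
    by real_asymp
  ultimately have "((\<lambda>t. dist a (t *\<^sub>R u) - t) \<longlongrightarrow> - m) at_top"
    by simp
  then show ?thesis
    unfolding busemann_def m_def by (intro tendsto_Lim) auto
qed

lemma vector_order_iff_diff_nonneg:
  assumes "vector_order ge"
  shows "ge x y \<longleftrightarrow> ge (x - y) 0"
proof -
  have "ge (x + z) (y + z)" if "ge x y" for x y z
    using assms that by (simp add: vector_order_def)
  from this[of x y "- y"] this[of "x - y" 0 y] show ?thesis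
    by auto
qed

lemma vector_order_scaleR_nonneg:
  assumes "vector_order ge" "ge x 0" "0 \<le> r"
  shows "ge (r *\<^sub>R x) 0"
  using assms unfolding vector_order_def by (metis scaleR_zero_right)

lemma vector_order_add_nonneg:
  assumes "vector_order ge" "ge x 0" "ge y 0"
  shows "ge (x + y) 0"
proof -
  have "ge (x + y) (0 + y)"
    using assms unfolding vector_order_def by blast
  then show ?thesis
    using assms unfolding vector_order_def by (metis add_0 transpD)
qed

text \<open>Minimizing the norm over all of the positive cone would only yield \<open>0\<close>. Over the points above
  \<open>p\<close> the minimizer is nonzero, since \<open>0 \<succcurlyeq> p \<succcurlyeq> 0\<close> would force \<open>p = 0\<close>, and these points are still
  stable under adding nonnegative vectors. Normalizing the minimizer gives the direction of the
  ray.\<close>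

lemma ex_nonneg_in_dual_cone:
  fixes ge :: "'a::{real_inner,complete_space} \<Rightarrow> 'a \<Rightarrow> bool"
  assumes "hilbert_poset ge" and "ge p 0" "p \<noteq> 0"
  shows "\<exists>u. ge u 0 \<and> norm u = 1 \<and> (\<forall>c. ge c 0 \<longrightarrow> 0 \<le> inner u c)"
proof -
  have vo: "vector_order ge" and clo: "closed {(x, y). ge x y}"
    using assms(1) by (auto simp: hilbert_poset_def)
  define S where "S = {x. ge x p}"
  have add_S: "x + c \<in> S" if "x \<in> S" "ge c 0" for x c
    using that vector_order_add_nonneg[OF vo, of "x - p" c] vector_order_iff_diff_nonneg[OF vo]
    by (metis S_def add_diff_eq add.commute diff_add_eq mem_Collect_eq)
  have "closed S"
  proof -
    have "S = (\<lambda>x. (x, p)) -` {(x, y). ge x y}"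
      by (auto simp: S_def)
    then show ?thesis
      using closed_vimage[OF clo, of "\<lambda>x. (x, p)"] by (simp add: continuous_on_Pair)
  qed
  moreover have "convex S"
  proof (rule convexI)
    fix x y :: 'a and a b :: real
    assume "x \<in> S" "y \<in> S" and ab: "0 \<le> a" "0 \<le> b" "a + b = 1"
    then have "ge (x - p) 0" "ge (y - p) 0"
      using vector_order_iff_diff_nonneg[OF vo] by (auto simp: S_def)
    then have "ge (a *\<^sub>R (x - p) + b *\<^sub>R (y - p)) 0"
      using ab by (intro vector_order_add_nonneg[OF vo] vector_order_scaleR_nonneg[OF vo])
    moreover have "a *\<^sub>R (x - p) + b *\<^sub>R (y - p) = a *\<^sub>R x + b *\<^sub>R y - (a + b) *\<^sub>R p"
      by (simp add: algebra_simps)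
    ultimately show "a *\<^sub>R x + b *\<^sub>R y \<in> S"
      using ab vector_order_iff_diff_nonneg[OF vo] by (simp add: S_def)
  qed
  moreover have "p \<in> S"
    using vo by (simp add: S_def vector_order_def reflpD)
  ultimately obtain u where "u \<in> S" and least: "\<And>x. x \<in> S \<Longrightarrow> norm u \<le> norm x"
    using least_norm_point_exists[of S] by blast
  have "u \<noteq> 0"
    using \<open>u \<in> S\<close> assms(2,3) vo unfolding S_def vector_order_def by (metis antisympD mem_Collect_eq)
  have "ge u 0"
    using \<open>u \<in> S\<close> assms(2) vo unfolding S_def vector_order_def by (metis transpD mem_Collect_eq)
  have "0 \<le> inner u c" if "ge c 0" for c
    using that \<open>u \<in> S\<close>
    by (intro inner_nonneg_if_least_norm_on_ray least add_S vector_order_scaleR_nonneg[OF vo]) auto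
  then have "ge (sgn u) 0" "norm (sgn u) = 1" "\<forall>c. ge c 0 \<longrightarrow> 0 \<le> inner (sgn u) c"
    using \<open>u \<noteq> 0\<close> \<open>ge u 0\<close> vector_order_scaleR_nonneg[OF vo, of u]
    by (auto simp: sgn_div_norm norm_sgn)
  then show ?thesis by blast
qed

theorem proposition10:
  fixes ge :: "'a::{real_inner,complete_space} \<Rightarrow> 'a \<Rightarrow> bool"
  assumes "hilbert_poset ge"
    and nontrivial: "\<exists>x y. ge x y \<and> x \<noteq> y"
  shows "\<exists>\<sigma> :: real \<Rightarrow> 'a.
           geodesic_ray \<sigma> \<and> order_preserving_ray ge \<sigma> \<and> order_decreasing ge (busemann \<sigma>)"
proof -
  have vo: "vector_order ge"
    using assms(1) by (simp add: hilbert_poset_def)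
  obtain x y where "ge x y" "x \<noteq> y"
    using nontrivial by blast
  then have "ge (x - y) 0" "x - y \<noteq> 0"
    using vector_order_iff_diff_nonneg[OF vo] by auto
  then obtain u where u: "ge u 0" "norm u = 1" "\<And>c. ge c 0 \<Longrightarrow> 0 \<le> inner u c"
    using ex_nonneg_in_dual_cone[OF assms(1)] by blast
  have "order_preserving_ray ge (\<lambda>t. t *\<^sub>R u)"
    unfolding order_preserving_ray_def
  proof (intro allI impI)
    fix s t :: real
    assume "t \<le> s \<and> 0 \<le> t"
    then have "ge ((s - t) *\<^sub>R u) 0"
      using u(1) by (intro vector_order_scaleR_nonneg[OF vo]) auto
    then show "ge (s *\<^sub>R u) (t *\<^sub>R u)"
      using vector_order_iff_diff_nonneg[OF vo] by (simp add: scaleR_diff_left)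
  qed
  moreover have "order_decreasing ge (busemann (\<lambda>t. t *\<^sub>R u))"
    unfolding order_decreasing_def busemann_line[OF u(2)]
  proof (intro allI impI)
    fix a b
    assume "ge a b"
    then have "0 \<le> inner u (a - b)"
      using vector_order_iff_diff_nonneg[OF vo] by (intro u(3)) blast
    then show "- inner a u \<le> - inner b u"
      by (simp add: inner_diff_right inner_commute)
  qed
  ultimately show ?thesis
    using geodesic_ray_line[OF u(2)] by blast
qed

end
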